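(* For every connected finite simple graph $G$ one can assign positive weights to the edges of $G$ so that the resulting weighted graph is both geodetic and antipodal.
   Context: In an edge-weighted graph, the length of a path is the sum of the weights of its edges, the distance between two vertices is the minimum length of a path between them, and a geodesic is a path of minimum length. A weighted graph is geodetic if between any two vertices there is exactly one geodesic. An antipode of a vertex $v$ is a vertex at maximum (weighted) distance from $v$; a weighted graph is antipodal if it is connected and every vertex has exactly one antipode. *)

theory Defs
  imports "Graph_Theory.Graph_Theory"
begin

text \<open>
  Finite simple graphs are modelled by \<^locale>\<open>pair_graph\<close>: every undirected edge is represented by
  its two orientations, which therefore have to carry the same weight.
\<close>

locale weighted_graph = pair_graph G for G :: "'a pair_pre_digraph" +
  fixes w :: "('a \<times> 'a) weight_fun"
  assumes weight_sym: "(u, v) \<in> parcs G \<Longrightarrow> w (v, u) = w (u, v)"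
begin

definition geodesic :: "'a \<Rightarrow> ('a \<times> 'a) awalk \<Rightarrow> 'a \<Rightarrow> bool" where
  "geodesic u p v \<longleftrightarrow> apath u p v \<and> (\<forall>q. apath u q v \<longrightarrow> awalk_cost w p \<le> awalk_cost w q)"

text \<open>
  There are only finitely many paths between two vertices. The value is meaningful only if there is
  at least one.
\<close>

definition distance :: "'a \<Rightarrow> 'a \<Rightarrow> real" where
  "distance u v = Min (awalk_cost w ` {p. apath u p v})"

definition geodetic :: bool where
  "geodetic \<longleftrightarrow> (\<forall>u \<in> pverts G. \<forall>v \<in> pverts G. \<exists>!p. geodesic u p v)"

definition antipode :: "'a \<Rightarrow> 'a \<Rightarrow> bool" where
  "antipode v u \<longleftrightarrow> u \<in> pverts G \<and> (\<forall>x \<in> pverts G. distance v x \<le> distance v u)"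

definition antipodal :: bool where
  "antipodal \<longleftrightarrow> connected (with_proj G) \<and> (\<forall>v \<in> pverts G. \<exists>!u. antipode v u)"

text \<open>For non-negative weights, this is the distance \<^term>\<open>\<mu> w u v\<close> of the library.\<close>

lemma distance_eq_mu:
  assumes "\<And>e. e \<in> parcs G \<Longrightarrow> 0 \<le> w e" and "u \<rightarrow>\<^sup>*\<^bsub>with_proj G\<^esub> v"
  shows "ereal (distance u v) = \<mu> w u v"
proof -
  obtain p where p: "apath u p v" "\<mu> w u v = ereal (awalk_cost w p)"
    using min_cost_awalk[of u v w] assms by auto
  have "finite {p. apath u p v}"
    using apaths_finite[of u v] by simp
  moreover have "awalk_cost w p \<le> awalk_cost w q" if "apath u q v" for q
    using min_cost_le_walk_cost[of u q v w] that p(2) by (simp add: apath_def)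
  ultimately have "distance u v = awalk_cost w p"
    unfolding distance_def using p(1) by (intro Min_eqI) auto
  then show ?thesis using p(2) by simp
qed

end

end

theory Submission
  imports Defs "HOL-Library.Nat_Bijection"
begin

text \<open>
  Give the edges distinct powers of two as weights, so that distinct sets of edges have distinct
  total weights. A path is determined by its start and its set of edges, hence distinct paths
  starting at the same vertex have distinct lengths. This makes geodesics unique, and it also makes
  the distances from a vertex to the other vertices pairwise distinct, so that exactly one vertex
  is farthest away.
\<close>

text \<open>The undirected edge under an arc. Weights will depend on an arc through this set only,
  so both orientations weigh the same.\<close>

definition edge_ends :: "'a \<times> 'a \<Rightarrow> 'a set" where
  "edge_ends e = {fst e, snd e}"

context pair_wf_digraph
begin

text \<open>Both ends of \<open>e\<close> are vertices of the remaining path \<open>p\<close>, and a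
  path does not revisit its start.\<close>

lemma start_notin_edge_ends:
  assumes "apath u (a # p) v" "e \<in> set p"
  shows "u \<notin> edge_ends e"
  using assms awalk_verts_arc1[of e p "snd a"] awalk_verts_arc2[of "snd a" p v e]
  by (auto simp: apath_simps edge_ends_def dest: awalkI_apath)

lemma edge_ends_Cons_notin:
  assumes "apath u (a # p) v" "u \<in> edge_ends e"
  shows "edge_ends e \<notin> edge_ends ` set p"
  using assms start_notin_edge_ends by fastforce

lemma start_in_edge_ends: "apath u (a # p) v \<Longrightarrow> u \<in> edge_ends a"
  by (simp add: apath_simps edge_ends_def)

text \<open>Not even the two orientations of one edge both occur on a path, so its cost is a sum
  over a set of undirected edges.\<close>

lemma distinct_edge_ends:
  "apath u p v \<Longrightarrow> distinct (map edge_ends p)"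
proof (induction p arbitrary: u)
  case (Cons a p)
  then show ?case
    using edge_ends_Cons_notin[OF Cons.prems start_in_edge_ends[OF Cons.prems]]
    by (auto simp: apath_simps)
qed simp

text \<open>A path never returns to its start, so its first arc is the only one that touches the start.\<close>

lemma apath_eq_if_edge_ends_eq:
  assumes "apath u p x" "apath u q y" "edge_ends ` set p = edge_ends ` set q"
  shows "p = q"
  using assms
proof (induction p arbitrary: u q)
  case (Cons a p)
  then obtain b q' where q: "q = b # q'" by (cases q) auto
  note path_q = Cons.prems(2)[unfolded q]
  have fst: "fst a = u" "fst b = u"
    using Cons.prems(1) path_q by (auto simp: apath_simps)
  have notin: "edge_ends a \<notin> edge_ends ` set p" "edge_ends a \<notin> edge_ends ` set q'"
    using edge_ends_Cons_notin Cons.prems(1) path_q start_in_edge_ends by metis+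
  then have eq: "edge_ends a = edge_ends b"
    using Cons.prems(3) q by auto
  \<comment> \<open>Both arcs leave \<open>u\<close>, which fixes the orientation of their common
    edge.\<close>
  then have "a = b" using fst by (auto simp: edge_ends_def doubleton_eq_iff prod_eq_iff)
  moreover have "edge_ends ` set p = edge_ends ` set q'"
    using Cons.prems(3) eq q notin by (simp add: insert_ident)
  ultimately show ?case using Cons q by (auto simp: apath_simps)
qed simp

text \<open>\<open>set_encode\<close> sums the powers of two with exponents in a finite set: the
  cost is a number whose binary digits mark the edges used.\<close>

lemma awalk_cost_power_of_two:
  assumes "apath u p v" "inj_on f (edge_ends ` parcs G)"
  shows "awalk_cost (\<lambda>e. 2 ^ f (edge_ends e)) p = real (set_encode (f ` edge_ends ` set p))"
proof -
  have "set p \<subseteq> parcs G" using assms(1) by (auto simp: apath_def)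
  then have inj: "inj_on f (edge_ends ` set p)"
    using assms(2) by (meson image_mono inj_on_subset)
  have "awalk_cost (\<lambda>e. 2 ^ f (edge_ends e)) p = (\<Sum>X\<leftarrow>map edge_ends p. 2 ^ f X)"
    by (simp add: awalk_cost_def o_def)
  also have "\<dots> = (\<Sum>X\<in>edge_ends ` set p. 2 ^ f X)"
    using distinct_edge_ends[OF assms(1)] sum_list_distinct_conv_sum_set[of "map edge_ends p" "\<lambda>X. 2 ^ f X :: real"]
    by simp
  also have "\<dots> = real (set_encode (f ` edge_ends ` set p))"
    unfolding set_encode_def by (subst sum.reindex[OF inj]) simp
  finally show ?thesis .
qed

text \<open>Binary expansions are unique, so the cost reveals the edge set and hence the path. The
  ends \<open>x\<close> and \<open>y\<close> may differ, as comparing distances to different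
  vertices requires.\<close>

lemma inj_awalk_cost_power_of_two:
  assumes "inj_on f (edge_ends ` parcs G)" "apath u p x" "apath u q y"
    and "awalk_cost (\<lambda>e. 2 ^ f (edge_ends e)) p = awalk_cost (\<lambda>e. 2 ^ f (edge_ends e)) q"
  shows "p = q"
proof -
  have sub: "edge_ends ` set p \<subseteq> edge_ends ` parcs G" "edge_ends ` set q \<subseteq> edge_ends ` parcs G"
    using assms(2,3) by (auto simp: apath_def)
  have "set_encode (f ` edge_ends ` set p) = set_encode (f ` edge_ends ` set q)"
    using assms by (simp add: awalk_cost_power_of_two)
  then have "f ` edge_ends ` set p = f ` edge_ends ` set q"
    by (rule inj_onD[OF inj_on_set_encode]) auto
  then have "edge_ends ` set p = edge_ends ` set q"
    using inj_on_image_eq_iff[OF assms(1) sub] by simp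
  then show ?thesis by (rule apath_eq_if_edge_ends_eq[OF assms(2,3)])
qed

end

context weighted_graph
begin

lemma distance_attained:
  assumes "connected (with_proj G)" "u \<in> pverts G" "v \<in> pverts G"
  obtains p where "apath u p v" "awalk_cost w p = distance u v"
    "\<And>q. apath u q v \<Longrightarrow> distance u v \<le> awalk_cost w q"
proof -
  let ?C = "awalk_cost w ` {p. apath u p v}"
  \<comment> \<open>All arcs come in both orientations, so connectedness yields directed paths and
    the minimum is over a nonempty set.\<close>
  have "u \<rightarrow>\<^sup>*\<^bsub>with_proj G\<^esub> v"
    using symmetric_connected_imp_strongly_connected[OF sym_arcs assms(1)] assms(2,3)
    by (auto elim: strongly_connectedE)
  then have "?C \<noteq> {}" by (simp add: reachable_apath)
  moreover have fin: "finite ?C" using apaths_finite by auto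
  ultimately have "distance u v \<in> ?C" unfolding distance_def by (rule Min_in[rotated])
  moreover have "distance u v \<le> awalk_cost w q" if "apath u q v" for q
    unfolding distance_def using fin that by (auto intro: Min_le)
  ultimately show ?thesis using that by auto
qed

text \<open>Injectivity with \<open>x = y\<close> makes geodesics unique; with arbitrary ends it
  makes the distances from a vertex pairwise distinct, so their maximum is attained once.\<close>

lemma geodetic_and_antipodal_if_inj_awalk_cost:
  assumes conn: "connected (with_proj G)"
    and inj: "\<And>u p q x y. apath u p x \<Longrightarrow> apath u q y \<Longrightarrow>
      awalk_cost w p = awalk_cost w q \<Longrightarrow> p = q"
  shows "geodetic" "antipodal"
proof -
  have "\<exists>!p. geodesic u p v" if uv: "u \<in> pverts G" "v \<in> pverts G" for u v
  proof -
    obtain p where p: "apath u p v" "awalk_cost w p = distance u v"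
      "\<And>q. apath u q v \<Longrightarrow> distance u v \<le> awalk_cost w q"
      using distance_attained[OF conn uv] by metis
    show ?thesis
    proof (rule ex1I[of _ p])
      show "geodesic u p v" using p by (simp add: geodesic_def)
      show "q = p" if "geodesic u q v" for q
        using that p by (intro inj[of u q v p v] antisym) (auto simp: geodesic_def)
    qed
  qed
  then show "geodetic" by (simp add: geodetic_def)
  have inj_dist: "x = y"
    if v: "v \<in> pverts G" and x: "x \<in> pverts G" and y: "y \<in> pverts G"
      and eq: "distance v x = distance v y" for v x y
  proof -
    obtain p where p: "apath v p x" "awalk_cost w p = distance v x"
      using distance_attained[OF conn v x] by metis
    obtain q where q: "apath v q y" "awalk_cost w q = distance v y"
      using distance_attained[OF conn v y] by metis
    have "p = q" using inj p q eq by metis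
    \<comment> \<open>The common start \<open>v\<close> settles the case of the empty path, whose
      end is its start.\<close>
    then show "x = y" using apath_ends[OF p(1)] q(1) by metis
  qed
  have "\<exists>!u. antipode v u" if v: "v \<in> pverts G" for v
  proof -
    let ?D = "distance v ` pverts G"
    have D: "finite ?D" "?D \<noteq> {}" using pair_finite_verts v by auto
    obtain u where u: "u \<in> pverts G" "distance v u = Max ?D"
      using Max_in[OF D] by (metis imageE)
    show ?thesis
    proof (rule ex1I[of _ u])
      show "antipode v u" using u D by (simp add: antipode_def)
      then show "u' = u" if "antipode v u'" for u'
        using that v by (intro inj_dist[of v u' u] antisym) (auto simp: antipode_def)
    qed
  qed
  with conn show "antipodal" by (simp add: antipodal_def)
qed

end

theorem theorem7:
  fixes G :: "'a pair_pre_digraph"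
  assumes "pair_graph G"
    and "connected (with_proj G)"
  shows "\<exists>w :: ('a \<times> 'a) weight_fun.
    weighted_graph G w \<and> (\<forall>e \<in> parcs G. 0 < w e) \<and>
    weighted_graph.geodetic G w \<and> weighted_graph.antipodal G w"
proof -
  interpret pair_graph G by fact
  \<comment> \<open>\<open>f\<close> numbers the finitely many undirected edges; these numbers
    become the exponents.\<close>
  obtain f :: "'a set \<Rightarrow> nat" where f: "inj_on f (edge_ends ` parcs G)"
    using finite_imp_inj_to_nat_seg[of "edge_ends ` parcs G"] pair_finite_arcs by blast
  define w :: "('a \<times> 'a) weight_fun" where "w = (\<lambda>e. 2 ^ f (edge_ends e))"
  interpret W: weighted_graph G w
    by unfold_locales (simp add: w_def edge_ends_def insert_commute)
  have inj: "p = q" if "apath u p x" "apath u q y" "awalk_cost w p = awalk_cost w q" for u p q x y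
    using inj_awalk_cost_power_of_two[OF f] that unfolding w_def by blast
  have "W.geodetic" "W.antipodal"
    by (rule W.geodetic_and_antipodal_if_inj_awalk_cost[OF assms(2)]; rule inj; assumption)+
  moreover have "\<forall>e \<in> parcs G. 0 < w e" by (simp add: w_def)
  ultimately show ?thesis using W.weighted_graph_axioms by blast
qed

end
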